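(* Let $(A,\mu,\alpha)$ be a Hom-alternative algebra over $\mathbf{k}$. Then the Hom-Bruck-Kleinfeld function $f$ satisfies, for all $w,x,y,z\in A$, $$f(w,x,y,z)=\tfrac13F(w,x,y,z)=as([w,x],\alpha(y),\alpha(z))+as([y,z],\alpha(w),\alpha(x)).$$
   Context: $\mathbf{k}$ is a fixed field of characteristic $0$; all modules, linear maps and tensor products are over $\mathbf{k}$. A Hom-algebra is a triple $(A,\mu,\alpha)$ with $A$ a $\mathbf{k}$-module, $\mu\colon A\otimes A\to A$ bilinear, written $\mu(a,b)=ab$ (not necessarily associative or unital), and $\alpha\colon A\to A$ linear with $\alpha(ab)=\alpha(a)\alpha(b)$ for all $a,b$. The Hom-associator is $as(x,y,z)=(xy)\alpha(z)-\alpha(x)(yz)$. $A$ is Hom-alternative if $as$ is alternating (changes by the sign of the permutation when its arguments are permuted). $[x,y]=xy-yx$ is the commutator bracket. The Hom-Bruck-Kleinfeld function $f\colon A^{\otimes4}\to A$ is $$f(w,x,y,z)=as(wx,\alpha(y),\alpha(z))-as(x,y,z)\alpha^2(w)-\alpha^2(x)as(w,y,z),$$ and $F\colon A^{\otimes 4}\to A$ is $$F(w,x,y,z)=[\alpha^2(w),as(x,y,z)]-[\alpha^2(z),as(w,x,y)]+[\alpha^2(y),as(z,w,x)]-[\alpha^2(x),as(y,z,w)].$$ *)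

theory Defs
  imports Complex_Main "HOL-Combinatorics.Permutations"
begin

locale hom_algebra = vector_space scale
  for scale :: "'k::field_char_0 \<Rightarrow> 'a::ab_group_add \<Rightarrow> 'a" (infixr \<open>*s\<close> 75) +
  fixes \<mu> :: "'a \<Rightarrow> 'a \<Rightarrow> 'a"
    and \<alpha> :: "'a \<Rightarrow> 'a"
  assumes linear_left: "\<And>y. Vector_Spaces.linear scale scale (\<lambda>x. \<mu> x y)"
    and linear_right: "\<And>x. Vector_Spaces.linear scale scale (\<mu> x)"
    and linear_twist: "Vector_Spaces.linear scale scale \<alpha>"
    and multiplicative: "\<And>x y. \<alpha> (\<mu> x y) = \<mu> (\<alpha> x) (\<alpha> y)"

(* Multilinear maps on tensor powers of the algebra are written as curried functions of
   several arguments. *)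

definition hom_associator ::
    "('a::ab_group_add \<Rightarrow> 'a \<Rightarrow> 'a) \<Rightarrow> ('a \<Rightarrow> 'a) \<Rightarrow> 'a \<Rightarrow> 'a \<Rightarrow> 'a \<Rightarrow> 'a" where
  "hom_associator \<mu> \<alpha> x y z = \<mu> (\<mu> x y) (\<alpha> z) - \<mu> (\<alpha> x) (\<mu> y z)"

definition commutator :: "('a::ab_group_add \<Rightarrow> 'a \<Rightarrow> 'a) \<Rightarrow> 'a \<Rightarrow> 'a \<Rightarrow> 'a" where
  "commutator \<mu> x y = \<mu> x y - \<mu> y x"

(* The three arguments are the values of x at 0, 1, 2, so that a permutation p of {0, 1, 2}
   acts on them by composition. *)
definition alternating3 ::
    "('k::field_char_0 \<Rightarrow> 'a::ab_group_add \<Rightarrow> 'a) \<Rightarrow> ('a \<Rightarrow> 'a \<Rightarrow> 'a \<Rightarrow> 'a) \<Rightarrow> bool" where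
  "alternating3 scale g \<longleftrightarrow>
     (\<forall>(x :: nat \<Rightarrow> 'a) p. p permutes {..<3} \<longrightarrow>
        g (x (p 0)) (x (p 1)) (x (p 2)) = scale (of_int (sign p)) (g (x 0) (x 1) (x 2)))"

locale hom_alternative_algebra = hom_algebra scale \<mu> \<alpha>
  for scale :: "'k::field_char_0 \<Rightarrow> 'a::ab_group_add \<Rightarrow> 'a" (infixr \<open>*s\<close> 75)
    and \<mu> :: "'a \<Rightarrow> 'a \<Rightarrow> 'a" and \<alpha> :: "'a \<Rightarrow> 'a" +
  assumes associator_alternating: "alternating3 scale (hom_associator \<mu> \<alpha>)"

definition hom_bruck_kleinfeld ::
    "('a::ab_group_add \<Rightarrow> 'a \<Rightarrow> 'a) \<Rightarrow> ('a \<Rightarrow> 'a) \<Rightarrow> 'a \<Rightarrow> 'a \<Rightarrow> 'a \<Rightarrow> 'a \<Rightarrow> 'a" where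
  "hom_bruck_kleinfeld \<mu> \<alpha> w x y z =
     hom_associator \<mu> \<alpha> (\<mu> w x) (\<alpha> y) (\<alpha> z)
     - \<mu> (hom_associator \<mu> \<alpha> x y z) ((\<alpha> ^^ 2) w)
     - \<mu> ((\<alpha> ^^ 2) x) (hom_associator \<mu> \<alpha> w y z)"

definition hom_cyclic_commutator ::
    "('a::ab_group_add \<Rightarrow> 'a \<Rightarrow> 'a) \<Rightarrow> ('a \<Rightarrow> 'a) \<Rightarrow> 'a \<Rightarrow> 'a \<Rightarrow> 'a \<Rightarrow> 'a \<Rightarrow> 'a" where
  "hom_cyclic_commutator \<mu> \<alpha> w x y z =
     commutator \<mu> ((\<alpha> ^^ 2) w) (hom_associator \<mu> \<alpha> x y z)
     - commutator \<mu> ((\<alpha> ^^ 2) z) (hom_associator \<mu> \<alpha> w x y)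
     + commutator \<mu> ((\<alpha> ^^ 2) y) (hom_associator \<mu> \<alpha> z w x)
     - commutator \<mu> ((\<alpha> ^^ 2) x) (hom_associator \<mu> \<alpha> y z w)"

end

theory Submission
  imports Defs
begin

text \<open>
  Write \<open>as\<close> for the Hom-associator. In every multiplicative Hom-algebra, expanding
  all five associators gives the Hom-Teichmueller identity
  \<open>as(wx, \<alpha>y, \<alpha>z) - as(\<alpha>w, xy, \<alpha>z) + as(\<alpha>w, \<alpha>x, yz) = \<alpha>\<^sup>2(w) as(x,y,z) + as(w,x,y) \<alpha>\<^sup>2(z)\<close>.
  If \<open>as\<close> is alternating, the product in each of the three associators on the left can be rotated
  into the first slot, and each of them is then a value of \<open>f\<close> at a cyclic rotation of
  \<open>(w,x,y,z)\<close> plus two correction terms. All the correction terms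
  combine into the commutators that make up \<open>F\<close>:
  \<open>F(w,x,y,z) = f(w,x,y,z) - f(x,y,z,w) + f(y,z,w,x)\<close>  (lemma \<open>cyclic_commutator_eq_rotations\<close>).

  The four summands of \<open>F\<close> alternate in sign along the rotation, so a rotation changes the sign
  of \<open>F\<close>. Adding the displayed equation to its rotation, the middle terms telescope and
  \<open>f(w,x,y,z) + f(z,w,x,y) = 0\<close> remains: \<open>f\<close> changes sign under rotation as well. The three
  terms on the right are therefore equal up to their signs, and \<open>F = 3f\<close>.

  Since \<open>f\<close> is skew in its last two arguments and changes sign under rotation, it is also skew in
  its first two. Hence \<open>2 f(w,x,y,z) = f(w,x,y,z) - f(x,w,y,z)\<close>, which is
  \<open>as([w,x], \<alpha>y, \<alpha>z)\<close> plus the commutators of \<open>F\<close> with \<open>\<alpha>\<^sup>2(w)\<close> and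
  \<open>\<alpha>\<^sup>2(x)\<close>. The same formula at \<open>(y,z,w,x)\<close>, where \<open>f\<close> has the same value, supplies the
  other two commutators. The sum of both is
  \<open>4f = as([w,x], \<alpha>y, \<alpha>z) + as([y,z], \<alpha>w, \<alpha>x) + F\<close>, and \<open>F = 3f\<close> gives the second formula.
\<close>

context hom_algebra
begin

abbreviation prod (infixl \<open>\<cdot>\<close> 70) where "x \<cdot> y \<equiv> \<mu> x y"
abbreviation associator (\<open>as\<close>) where "as \<equiv> hom_associator \<mu> \<alpha>"
abbreviation bracket (\<open>\<lbrakk>_, _\<rbrakk>\<close>) where "\<lbrakk>x, y\<rbrakk> \<equiv> commutator \<mu> x y"
abbreviation bruck_kleinfeld (\<open>f\<close>) where "f \<equiv> hom_bruck_kleinfeld \<mu> \<alpha>"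
abbreviation cyclic_commutator (\<open>F\<close>) where "F \<equiv> hom_cyclic_commutator \<mu> \<alpha>"

lemma prod_diff_left: "(x - y) \<cdot> z = x \<cdot> z - y \<cdot> z"
  using linear_left[of z] by (rule module_hom.diff[OF Vector_Spaces.linear.axioms(3)])

lemma prod_diff_right: "x \<cdot> (y - z) = x \<cdot> y - x \<cdot> z"
  using linear_right[of x] by (rule module_hom.diff[OF Vector_Spaces.linear.axioms(3)])

lemma prod_minus_left: "(- x) \<cdot> z = - (x \<cdot> z)"
  using linear_left[of z] by (rule module_hom.neg[OF Vector_Spaces.linear.axioms(3)])

lemma prod_minus_right: "x \<cdot> (- z) = - (x \<cdot> z)"
  using linear_right[of x] by (rule module_hom.neg[OF Vector_Spaces.linear.axioms(3)])

lemma twist_diff: "\<alpha> (x - y) = \<alpha> x - \<alpha> y"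
  using linear_twist by (rule module_hom.diff[OF Vector_Spaces.linear.axioms(3)])

lemma associator_diff_left: "as (u - v) y z = as u y z - as v y z"
  by (simp add: hom_associator_def prod_diff_left twist_diff)

text \<open>
  Multiplicativity of \<open>\<alpha>\<close> is what makes the ten products cancel in pairs: for instance
  \<open>as(wx, \<alpha>y, \<alpha>z)\<close> ends in \<open>\<alpha>(wx) (\<alpha>y \<alpha>z)\<close>, which \<open>as(\<alpha>w, \<alpha>x, yz)\<close> contains
  as \<open>(\<alpha>w \<alpha>x) \<alpha>(yz)\<close>.
\<close>
lemma teichmueller:
  "as (w \<cdot> x) (\<alpha> y) (\<alpha> z) - as (\<alpha> w) (x \<cdot> y) (\<alpha> z) + as (\<alpha> w) (\<alpha> x) (y \<cdot> z)
    = (\<alpha> ^^ 2) w \<cdot> as x y z + as w x y \<cdot> (\<alpha> ^^ 2) z"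
  by (simp add: hom_associator_def numeral_2_eq_2 multiplicative prod_diff_left prod_diff_right
      algebra_simps)

end

context hom_alternative_algebra
begin

lemma associator_swap12: "as y x z = - as x y z"
proof -
  let ?v = "\<lambda>i. [x, y, z] ! i" and ?p = "transpose 0 (1::nat)"
  have "?p permutes {..<3}"
    by (rule permutes_swap_id) auto
  then have "as (?v (?p 0)) (?v (?p 1)) (?v (?p 2))
      = scale (of_int (sign ?p)) (as (?v 0) (?v 1) (?v 2))"
    using associator_alternating unfolding alternating3_def by blast
  then show ?thesis
    by (simp add: transpose_def sign_swap_id)
qed

lemma associator_swap23: "as x z y = - as x y z"
proof -
  let ?v = "\<lambda>i. [x, y, z] ! i" and ?p = "transpose 1 (2::nat)"
  have "?p permutes {..<3}"
    by (rule permutes_swap_id) auto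
  then have "as (?v (?p 0)) (?v (?p 1)) (?v (?p 2))
      = scale (of_int (sign ?p)) (as (?v 0) (?v 1) (?v 2))"
    using associator_alternating unfolding alternating3_def by blast
  then show ?thesis
    by (simp add: transpose_def sign_swap_id)
qed

lemma associator_rotate: "as x y z = as y z x"
  by (simp add: associator_swap12[of x y z] associator_swap23[of y x z])

lemma bruck_kleinfeld_swap34: "f w x z y = - f w x y z"
  by (simp add: hom_bruck_kleinfeld_def associator_swap23[of _ y z]
      associator_swap23[of _ "\<alpha> y" "\<alpha> z"] prod_minus_left prod_minus_right)

text \<open>The Hom-Teichmueller identity, rewritten so that \<open>f\<close> takes the place of the associators
  that have a product as an argument.\<close>
lemma cyclic_commutator_eq_rotations:
  "F w x y z = f w x y z - f x y z w + f y z w x"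
proof -
  have "as (w \<cdot> x) (\<alpha> y) (\<alpha> z) - as (x \<cdot> y) (\<alpha> z) (\<alpha> w) + as (y \<cdot> z) (\<alpha> w) (\<alpha> x)
      = (\<alpha> ^^ 2) w \<cdot> as x y z + as w x y \<cdot> (\<alpha> ^^ 2) z"
    using teichmueller[of w x y z]
    by (simp add: associator_rotate[of "\<alpha> w" "x \<cdot> y" "\<alpha> z"]
        associator_rotate[of "y \<cdot> z" "\<alpha> w" "\<alpha> x", symmetric])
  then show ?thesis
    unfolding hom_bruck_kleinfeld_def hom_cyclic_commutator_def commutator_def
    by (simp add: associator_rotate[of w y z] associator_rotate[of x z w]
        associator_rotate[of y w x] algebra_simps)
qed

lemma cyclic_commutator_rotate: "F x y z w = - F w x y z"
  by (simp add: hom_cyclic_commutator_def)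

lemma bruck_kleinfeld_rotate: "f x y z w = - f w x y z"
proof -
  \<comment> \<open>The sum of the expansions of \<open>F y z w x\<close> and \<open>F x y z w\<close>; all other values of \<open>f\<close> cancel.\<close>
  have "f w x y z + f x y z w = F x y z w + F y z w x"
    by (simp add: cyclic_commutator_eq_rotations)
  also have "\<dots> = 0"
    by (simp add: cyclic_commutator_rotate[of y z w x])
  finally show ?thesis
    by (simp add: eq_neg_iff_add_eq_0 add.commute)
qed

lemma cyclic_commutator_eq_bruck_kleinfeld:
  "F w x y z = f w x y z + f w x y z + f w x y z"
  by (simp add: cyclic_commutator_eq_rotations bruck_kleinfeld_rotate[of x y z w]
      bruck_kleinfeld_rotate[of y z w x])

lemma bruck_kleinfeld_rotate2: "f y z w x = f w x y z"
  by (simp add: bruck_kleinfeld_rotate[of y z w x] bruck_kleinfeld_rotate[of x y z w])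

text \<open>Rotating twice exchanges the two halves of the argument list, which carries the skew symmetry
  in the last two arguments over to the first two.\<close>
lemma bruck_kleinfeld_swap12: "f x w y z = - f w x y z"
  by (metis bruck_kleinfeld_rotate2 bruck_kleinfeld_swap34)

lemma bruck_kleinfeld_double:
  "f w x y z + f w x y z
    = as \<lbrakk>w, x\<rbrakk> (\<alpha> y) (\<alpha> z) + \<lbrakk>(\<alpha> ^^ 2) w, as x y z\<rbrakk> - \<lbrakk>(\<alpha> ^^ 2) x, as w y z\<rbrakk>"
proof -
  have "f w x y z + f w x y z = f w x y z - f x w y z"
    by (simp add: bruck_kleinfeld_swap12[of x w])
  then show ?thesis
    by (simp add: hom_bruck_kleinfeld_def commutator_def associator_diff_left algebra_simps)
qed

lemma bruck_kleinfeld_eq_associators: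
  "f w x y z = as \<lbrakk>w, x\<rbrakk> (\<alpha> y) (\<alpha> z) + as \<lbrakk>y, z\<rbrakk> (\<alpha> w) (\<alpha> x)"
proof -
  let ?f = "f w x y z"
  have "(?f + ?f) + (?f + ?f)
      = as \<lbrakk>w, x\<rbrakk> (\<alpha> y) (\<alpha> z) + as \<lbrakk>y, z\<rbrakk> (\<alpha> w) (\<alpha> x) + F w x y z"
    using bruck_kleinfeld_double[of w x y z] bruck_kleinfeld_double[of y z w x]
    by (simp add: bruck_kleinfeld_rotate2[of y z w x] hom_cyclic_commutator_def
        associator_rotate[of w y z] associator_rotate[of y w x] algebra_simps)
  then show ?thesis
    by (simp add: cyclic_commutator_eq_bruck_kleinfeld algebra_simps)
qed

lemma bruck_kleinfeld_eq_third: "f w x y z = scale (1 / 3) (F w x y z)"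
proof -
  have "F w x y z = scale (1 + 1 + 1) (f w x y z)"
    by (simp only: cyclic_commutator_eq_bruck_kleinfeld scale_left_distrib scale_one)
  then show ?thesis
    by simp
qed

end

theorem proposition6p3:
  fixes scale :: "'k::field_char_0 \<Rightarrow> 'a::ab_group_add \<Rightarrow> 'a"
    and \<mu> :: "'a \<Rightarrow> 'a \<Rightarrow> 'a" and \<alpha> :: "'a \<Rightarrow> 'a" and w x y z :: 'a
  assumes "hom_alternative_algebra scale \<mu> \<alpha>"
  shows "hom_bruck_kleinfeld \<mu> \<alpha> w x y z = scale (1 / 3) (hom_cyclic_commutator \<mu> \<alpha> w x y z)
    \<and> scale (1 / 3) (hom_cyclic_commutator \<mu> \<alpha> w x y z) =
        hom_associator \<mu> \<alpha> (commutator \<mu> w x) (\<alpha> y) (\<alpha> z)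
        + hom_associator \<mu> \<alpha> (commutator \<mu> y z) (\<alpha> w) (\<alpha> x)"
proof -
  interpret hom_alternative_algebra scale \<mu> \<alpha>
    by (rule assms)
  show ?thesis
    using bruck_kleinfeld_eq_third[of w x y z] bruck_kleinfeld_eq_associators[of w x y z] by simp
qed

end
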